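(* Let $M\in\mathbb{N}$, $\alpha=q^{-M}$ and $\max\{|\lambda t|,|\lambda xt|\}<1$. Then $$\sum_{n=0}^\infty\phi_n^{(\alpha)}(x|q)\,p_n(\lambda,\mu,a)\frac{t^n}{(q;q)_n}=\frac{(\alpha\lambda xt;q)_\infty}{(\lambda xt,\lambda t;q)_\infty}\sum_{k=0}^\infty\frac{(-1)^kq^{k(k-1)/2}(a,\alpha,\lambda t;q)_k\,(\mu xt)^k}{(\alpha\lambda xt,q;q)_k}\;{}_1\Phi_1\left[\begin{array}{c}aq^k\\ 0\end{array};q;\,\mu tq^k\right].$$
   Context: $q$ is a fixed complex number with $0<|q|<1$; $a,x,t,\lambda,\mu$ are complex numbers for which the expressions are defined (the denominators $(\alpha\lambda xt;q)_k$ that occur do not vanish). The $q$-shifted factorials are $(a;q)_0=1$, $(a;q)_n=\prod_{i=0}^{n-1}(1-aq^i)$, $(a;q)_\infty=\prod_{i=0}^\infty(1-aq^i)$, and $(a_1,\dots,a_m;q)_n=\prod_j(a_j;q)_n$ (also for $n=\infty$). The series ${}_1\Phi_1$ is $${}_1\Phi_1\left[\begin{array}{c}a\\ 0\end{array};q;z\right]=\sum_{n=0}^\infty(-1)^nq^{n(n-1)/2}\frac{(a;q)_n}{(q;q)_n}z^n.$$ With $\binom{n}{k}_q=\frac{(q;q)_n}{(q;q)_k(q;q)_{n-k}}$, the Hahn (Al-Salam–Carlitz) polynomials are $$\phi_n^{(\alpha)}(x|q)=\sum_{k=0}^n\binom{n}{k}_q(\alpha;q)_k\,x^k,$$ and the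 generalized Cauchy polynomials are $$p_n(x,y,a)=\sum_{k=0}^n\binom{n}{k}_q(-1)^kq^{k(k-1)/2}(a;q)_k\,x^{n-k}y^k.$$ *)

theory Defs
  imports "HOL-Analysis.Analysis"
begin

definition qpoch :: "complex \<Rightarrow> complex \<Rightarrow> nat \<Rightarrow> complex" where
  "qpoch a q n = (\<Prod>i<n. 1 - a * q ^ i)"

definition qpoch_inf :: "complex \<Rightarrow> complex \<Rightarrow> complex" where
  "qpoch_inf a q = (\<Prod>i. 1 - a * q ^ i)"

definition qbinom :: "complex \<Rightarrow> nat \<Rightarrow> nat \<Rightarrow> complex" where
  "qbinom q n k = qpoch q q n / (qpoch q q k * qpoch q q (n - k))"

text \<open>With lower parameter \<open>0\<close> the usual denominator factor \<open>(0;q)\<^sub>n\<close> equals \<open>1\<close>.\<close>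

definition Phi11_0 :: "complex \<Rightarrow> complex \<Rightarrow> complex \<Rightarrow> complex" where
  "Phi11_0 a q z =
     (\<Sum>n. (-1) ^ n * q ^ (n * (n - 1) div 2) * (qpoch a q n / qpoch q q n) * z ^ n)"

definition hahn_poly :: "complex \<Rightarrow> complex \<Rightarrow> nat \<Rightarrow> complex \<Rightarrow> complex" where
  "hahn_poly q \<alpha> n x = (\<Sum>k\<le>n. qbinom q n k * qpoch \<alpha> q k * x ^ k)"

definition cauchy_poly :: "complex \<Rightarrow> nat \<Rightarrow> complex \<Rightarrow> complex \<Rightarrow> complex \<Rightarrow> complex" where
  "cauchy_poly q n x y a =
     (\<Sum>k\<le>n. qbinom q n k * (-1) ^ k * q ^ (k * (k - 1) div 2) * qpoch a q k
              * x ^ (n - k) * y ^ k)"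

end

theory Submission
  imports Defs
begin

text \<open>
  Write \<open>z = \<lambda>t\<close> and \<open>y = \<mu>t\<close>. Expanding the Cauchy polynomial by its definition and summing
  first over the remaining index turns the left-hand side into
  \<open>\<Sum>\<^sub>j c\<^sub>j G\<^sub>j(z)\<close>, where \<open>c\<^sub>j = (-1)\<^sup>j q\<^bsup>j(j-1)/2\<^esup> (a;q)\<^sub>j y\<^sup>j / (q;q)\<^sub>j\<close> is the general term of
  \<open>\<^sub>1\<Phi>\<^sub>1[a; 0; q; y]\<close> and \<open>G\<^sub>j(z) = \<Sum>\<^sub>m \<phi>\<^bsub>m+j\<^esub> z\<^sup>m / (q;q)\<^sub>m\<close> is the generating function of the Hahn
  polynomials with shifted index.

  The heart of the matter is a closed form for \<open>G\<^sub>j\<close> (\<open>hahn_shifted_generating_function\<close>):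
  \<open>G\<^sub>j(z) = P(z) \<Sum>\<^bsub>k\<le>j\<^esub> (j choose k)\<^sub>q (\<alpha>;q)\<^sub>k (z;q)\<^sub>k x\<^sup>k / (\<alpha>xz;q)\<^sub>k\<close>, with the infinite product
  \<open>P(z) = (\<alpha>xz;q)\<^sub>\<infinity> / ((xz;q)\<^sub>\<infinity> (z;q)\<^sub>\<infinity>)\<close>. For \<open>j = 0\<close> this is the Cauchy product of two instances
  of the \<open>q\<close>-binomial theorem. Since \<open>z\<^sup>m (1 - q\<^sup>m) / (q;q)\<^sub>m = z \<cdot> z\<^bsup>m-1\<^esup> / (q;q)\<^bsub>m-1\<^esub>\<close>, the functions obey
  \<open>z G\<^bsub>j+1\<^esub>(z) = G\<^sub>j(z) - G\<^sub>j(qz)\<close>, and the closed form obeys the same recurrence by the \<open>q\<close>-Pascal rule.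

  On the right-hand side, the factorisation of \<open>c\<^bsub>k+n\<^esub> (k+n choose k)\<^sub>q\<close> (\<open>Phi11_0_term_add\<close>) shows that
  the summands with \<open>k + n = j\<close>, where \<open>n\<close> is the index of the inner \<open>\<^sub>1\<Phi>\<^sub>1\<close>, add up to
  \<open>c\<^sub>j G\<^sub>j(z) / P(z)\<close>. Both sides are therefore equal to \<open>\<Sum>\<^sub>j c\<^sub>j G\<^sub>j(z)\<close>. The two rearrangements of double
  series are instances of \<open>sums_diagonals\<close>; the quadratic exponent in \<open>c\<^sub>j\<close> provides the absolute
  convergence. The theorem is the case \<open>\<alpha> = q\<^bsup>-M\<^esup>\<close> of \<open>hahn_cauchy_generating_function\<close>.
\<close>

section \<open>Shifted factorials\<close>

lemma qpoch_0 [simp]: "qpoch a q 0 = 1"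
  by (simp add: qpoch_def)

lemma qpoch_zero [simp]: "qpoch 0 q n = 1"
  by (simp add: qpoch_def)

lemma qpoch_Suc: "qpoch a q (Suc n) = qpoch a q n * (1 - a * q ^ n)"
  by (simp add: qpoch_def)

lemma qpoch_Suc_shift: "qpoch a q (Suc n) = (1 - a) * qpoch (a * q) q n"
  by (simp add: qpoch_def prod.lessThan_Suc_shift mult.assoc del: prod.lessThan_Suc)

lemma qpoch_add: "qpoch a q (k + n) = qpoch a q k * qpoch (a * q ^ k) q n"
  by (induction n) (simp_all add: qpoch_Suc power_add mult_ac)

lemma qpoch_nonzero:
  assumes "norm q < 1" "norm z < 1"
  shows "qpoch z q n \<noteq> 0"
proof -
  have "1 - z * q ^ i \<noteq> 0" for i
  proof -
    have "norm (z * q ^ i) \<le> norm z * 1"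
      unfolding norm_mult norm_power using assms
      by (intro mult_left_mono power_le_one) auto
    thus ?thesis using assms by auto
  qed
  thus ?thesis by (simp add: qpoch_def)
qed

lemma convergent_prod_qpoch:
  fixes a q :: complex
  assumes "norm q < 1"
  shows "convergent_prod (\<lambda>i. 1 - a * q ^ i)"
proof (rule abs_convergent_prod_imp_convergent_prod)
  show "abs_convergent_prod (\<lambda>i. 1 - a * q ^ i)"
    unfolding abs_convergent_prod_conv_summable using assms
    by (simp add: norm_mult norm_power summable_mult summable_geometric)
qed

lemma qpoch_LIMSEQ:
  assumes "norm q < 1"
  shows "(\<lambda>n. qpoch a q n) \<longlonglongrightarrow> qpoch_inf a q"
proof -
  have "(\<lambda>n. \<Prod>i\<le>n. 1 - a * q ^ i) \<longlonglongrightarrow> qpoch_inf a q"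
    unfolding qpoch_inf_def by (rule convergent_prod_LIMSEQ[OF convergent_prod_qpoch[OF assms]])
  hence "(\<lambda>n. qpoch a q (Suc n)) \<longlonglongrightarrow> qpoch_inf a q"
    by (simp add: qpoch_def lessThan_Suc_atMost)
  thus ?thesis by (rule LIMSEQ_imp_Suc)
qed

lemma qpoch_inf_shift:
  assumes "norm q < 1"
  shows "qpoch_inf z q = (1 - z) * qpoch_inf (z * q) q"
proof (rule LIMSEQ_unique)
  show "(\<lambda>n. qpoch z q (Suc n)) \<longlonglongrightarrow> qpoch_inf z q"
    using qpoch_LIMSEQ[OF assms] by (rule LIMSEQ_Suc)
  show "(\<lambda>n. qpoch z q (Suc n)) \<longlonglongrightarrow> (1 - z) * qpoch_inf (z * q) q"
    unfolding qpoch_Suc_shift by (intro tendsto_intros qpoch_LIMSEQ assms)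
qed

lemma qpoch_inf_nonzero:
  assumes "norm q < 1" "\<And>n. qpoch a q n \<noteq> 0"
  shows "qpoch_inf a q \<noteq> 0"
  unfolding qpoch_inf_def
proof (rule prodinf_nonzero[OF convergent_prod_qpoch[OF assms(1)]])
  show "1 - a * q ^ i \<noteq> 0" for i
    using assms(2)[of "Suc i"] by (simp add: qpoch_Suc)
qed

lemma qpoch_bounded:
  assumes "norm q < 1"
  obtains C where "C > 0" "\<And>n. norm (qpoch a q n) \<le> C"
proof -
  have "Bseq (\<lambda>n. qpoch a q n)"
    using qpoch_LIMSEQ[OF assms] by (intro convergent_imp_Bseq convergentI)
  thus ?thesis using that by (auto simp: Bseq_def)
qed

lemma inverse_qpoch_bounded:
  assumes "norm q < 1" "\<And>n. qpoch a q n \<noteq> 0"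
  obtains C where "C > 0" "\<And>n. norm (inverse (qpoch a q n)) \<le> C"
proof -
  have "(\<lambda>n. inverse (qpoch a q n)) \<longlonglongrightarrow> inverse (qpoch_inf a q)"
    by (intro tendsto_inverse qpoch_LIMSEQ qpoch_inf_nonzero assms)
  hence "Bseq (\<lambda>n. inverse (qpoch a q n))"
    by (intro convergent_imp_Bseq convergentI)
  thus ?thesis using that by (auto simp: Bseq_def)
qed

lemma qpoch_ratio_bounded:
  assumes "norm q < 1" "\<And>n. qpoch b q n \<noteq> 0"
  obtains C where "C > 0" "\<And>n. norm (qpoch a q n / qpoch b q n) \<le> C"
proof -
  obtain A where A: "A > 0" "\<And>n. norm (qpoch a q n) \<le> A"
    using qpoch_bounded[OF assms(1)] by blast
  obtain B where B: "B > 0" "\<And>n. norm (inverse (qpoch b q n)) \<le> B"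
    using inverse_qpoch_bounded[OF assms] by blast
  show ?thesis
  proof (rule that[of "A * B"])
    show "norm (qpoch a q n / qpoch b q n) \<le> A * B" for n
      unfolding divide_inverse norm_mult using A B by (intro mult_mono) auto
  qed (use A B in auto)
qed

lemma triangular_Suc: "Suc n * (Suc n - 1) div 2 = n * (n - 1) div 2 + n"
proof -
  have "Suc n * (Suc n - 1) = n * (n - 1) + n * 2"
    by (cases n) simp_all
  thus ?thesis by simp
qed

lemma triangular_add:
  fixes k n :: nat
  shows "(k + n) * (k + n - 1) div 2 = k * (k - 1) div 2 + n * (n - 1) div 2 + k * n"
proof (induction n)
  case (Suc n)
  have "(k + Suc n) * (k + Suc n - 1) div 2 = (k + n) * (k + n - 1) div 2 + (k + n)"
    using triangular_Suc[of "k + n"] by (simp only: add_Suc_right)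
  also have "\<dots> = (k * (k - 1) div 2 + n * (n - 1) div 2 + k * n) + (k + n)"
    by (simp only: Suc.IH)
  also have "\<dots> = k * (k - 1) div 2 + (n * (n - 1) div 2 + n) + (k + k * n)"
    by (simp only: ac_simps)
  also have "\<dots> = k * (k - 1) div 2 + Suc n * (Suc n - 1) div 2 + k * Suc n"
    by (simp only: triangular_Suc mult_Suc_right)
  finally show ?case .
qed simp

section \<open>The q-binomial theorem\<close>

lemma qbinom_0 [simp]: "norm q < 1 \<Longrightarrow> qbinom q n 0 = 1"
  by (simp add: qbinom_def qpoch_nonzero)

lemma qbinom_self [simp]: "norm q < 1 \<Longrightarrow> qbinom q n n = 1"
  by (simp add: qbinom_def qpoch_nonzero)

text \<open>
  Of the two \<open>q\<close>-analogues of the Pascal rule, this is the one with weight \<open>q\<^sup>k\<close>: after division by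
  the common factors it reads \<open>1 - KD = K(1 - D) + (1 - K)\<close> with \<open>K = q\<^bsup>k+1\<^esup>\<close> and \<open>D = q\<^bsup>n-k\<^esup>\<close>.
\<close>

lemma qbinom_pascal:
  assumes q: "norm q < 1" and k: "Suc k \<le> n"
  shows "qbinom q (Suc n) (Suc k) = q ^ Suc k * qbinom q n (Suc k) + qbinom q n k"
proof -
  obtain d where n: "n = Suc k + d" using k by (rule le_Suc_ex[elim_format]) blast
  have nz: "qpoch q q i \<noteq> 0" "1 - q ^ Suc i \<noteq> 0" for i
    using qpoch_nonzero[OF q q, of i] qpoch_nonzero[OF q q, of "Suc i"]
    by (auto simp only: qpoch_Suc mult_eq_0_iff power_Suc)
  have split: "Q * (1 - K * D) / (A * (1 - K) * (B * (1 - D))) =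
      K * (Q / (A * (1 - K) * B)) + Q / (A * (B * (1 - D)))"
    if "A \<noteq> 0" "B \<noteq> 0" "1 - K \<noteq> 0" "1 - D \<noteq> 0" for A B Q K D :: complex
  proof -
    have "Q * (1 - K * D) = K * Q * (1 - D) + Q * (1 - K)" by (simp add: algebra_simps)
    also have "\<dots> / (A * (1 - K) * (B * (1 - D))) =
        K * Q * (1 - D) / (A * (1 - K) * (B * (1 - D))) + Q * (1 - K) / (A * (1 - K) * (B * (1 - D)))"
      by (rule add_divide_distrib)
    finally show ?thesis using that by simp
  qed
  have "q ^ Suc n = q ^ Suc k * q ^ Suc d" by (simp only: n power_add power_Suc ac_simps)
  moreover have "Suc n - Suc k = Suc d" "n - Suc k = d" "n - k = Suc d" using n by simp_all
  ultimately show ?thesis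
    using split[OF nz(1)[of k] nz(1)[of d] nz(2)[of k] nz(2)[of d], of "qpoch q q n"]
    by (simp only: qbinom_def qpoch_Suc power_Suc)
qed

lemma summable_norm_qbinomial:
  assumes "norm q < 1" "norm z < 1"
  shows "summable (\<lambda>n. norm (qpoch a q n / qpoch q q n * z ^ n))"
proof -
  obtain C where C: "C > 0" "\<And>n. norm (qpoch a q n / qpoch q q n) \<le> C"
    using qpoch_ratio_bounded[OF assms(1) qpoch_nonzero[OF assms(1) assms(1)]] by blast
  show ?thesis
  proof (rule summable_comparison_test)
    show "summable (\<lambda>n. C * norm z ^ n)"
      using assms by (intro summable_mult summable_geometric) auto
    have "norm (qpoch a q n / qpoch q q n * z ^ n) \<le> C * norm z ^ n" for n
      unfolding norm_mult[of "_ / _"] norm_power using C by (intro mult_right_mono) auto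
    thus "\<exists>N. \<forall>n\<ge>N. norm (norm (qpoch a q n / qpoch q q n * z ^ n)) \<le> C * norm z ^ n"
      by auto
  qed
qed

text \<open>
  The first-order recurrence of the coefficients says that the sum \<open>F\<close> satisfies
  \<open>(1 - w) F(w) = (1 - aw) F(qw)\<close>. Iterating this equation pushes the argument to \<open>0\<close>, where \<open>F\<close> is
  continuous with value \<open>1\<close>, and the accumulated factors tend to the two infinite products.
\<close>

theorem q_binomial_theorem:
  assumes q: "norm q < 1" and z: "norm z < 1"
  shows "(\<lambda>n. qpoch a q n / qpoch q q n * z ^ n) sums (qpoch_inf (a * z) q / qpoch_inf z q)"
proof -
  define c where "c n = qpoch a q n / qpoch q q n" for n
  define F where "F w = (\<Sum>n. c n * w ^ n)" for w
  have sm: "summable (\<lambda>n. c n * w ^ n)" if "norm w < 1" for w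
    using summable_norm_cancel[OF summable_norm_qbinomial[OF q that]] by (simp add: c_def)
  have small: "norm (w * q ^ n) < 1" if "norm w < 1" for w n
  proof -
    have "norm (w * q ^ n) \<le> norm w * 1"
      unfolding norm_mult norm_power using q by (intro mult_left_mono power_le_one) auto
    thus ?thesis using that by simp
  qed
  have rec: "c (Suc n) * (1 - q ^ Suc n) = c n * (1 - a * q ^ n)" for n
    using qpoch_nonzero[OF q q, of n] qpoch_nonzero[OF q q, of "Suc n"]
    by (simp add: c_def qpoch_Suc divide_simps)
  have step: "F w * (1 - w) = (1 - a * w) * F (w * q)" if w: "norm w < 1" for w
  proof -
    have wq: "norm (w * q) < 1" using small[OF w, of 1] by simp
    have s: "(\<lambda>n. c n * w ^ n) sums F w" "(\<lambda>n. c n * (w * q) ^ n) sums F (w * q)"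
      unfolding F_def using sm[OF w] sm[OF wq] by (simp_all add: summable_sums)
    have "(\<lambda>n. c n * w ^ n - c n * (w * q) ^ n) sums (F w - F (w * q))"
      by (intro sums_diff s)
    hence "(\<lambda>n. c (Suc n) * w ^ Suc n - c (Suc n) * (w * q) ^ Suc n) sums (F w - F (w * q))"
      by (subst sums_Suc_iff) simp
    moreover have "c (Suc n) * w ^ Suc n - c (Suc n) * (w * q) ^ Suc n
        = w * (c n * w ^ n) - a * w * (c n * (w * q) ^ n)" for n
    proof -
      have "c (Suc n) * w ^ Suc n - c (Suc n) * (w * q) ^ Suc n
          = (c (Suc n) * (1 - q ^ Suc n)) * w ^ Suc n"
        by (simp add: algebra_simps power_mult_distrib)
      also have "\<dots> = w * (c n * w ^ n) - a * w * (c n * (w * q) ^ n)"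
        unfolding rec by (simp add: algebra_simps power_mult_distrib)
      finally show ?thesis .
    qed
    ultimately have "(\<lambda>n. w * (c n * w ^ n) - a * w * (c n * (w * q) ^ n)) sums (F w - F (w * q))"
      by simp
    moreover have "(\<lambda>n. w * (c n * w ^ n) - a * w * (c n * (w * q) ^ n))
        sums (w * F w - a * w * F (w * q))"
      by (intro sums_diff sums_mult s)
    ultimately have "F w - F (w * q) = w * F w - a * w * F (w * q)"
      by (rule sums_unique2)
    thus ?thesis by (simp add: algebra_simps)
  qed
  have iter: "F z * qpoch z q n = qpoch (a * z) q n * F (z * q ^ n)" for n
  proof (induction n)
    case (Suc n)
    have "F z * qpoch z q (Suc n) = (F z * qpoch z q n) * (1 - z * q ^ n)"
      by (simp add: qpoch_Suc)
    also have "\<dots> = qpoch (a * z) q n * (F (z * q ^ n) * (1 - z * q ^ n))"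
      unfolding Suc by simp
    also have "\<dots> = qpoch (a * z) q (Suc n) * F (z * q ^ Suc n)"
      unfolding step[OF small[OF z]] by (simp add: qpoch_Suc mult_ac)
    finally show ?case .
  qed simp
  have "F z * qpoch_inf z q = qpoch_inf (a * z) q * F 0"
  proof (rule LIMSEQ_unique)
    show "(\<lambda>n. F z * qpoch z q n) \<longlonglongrightarrow> F z * qpoch_inf z q"
      by (intro tendsto_intros qpoch_LIMSEQ q)
    have "(\<lambda>n. z * q ^ n) \<longlonglongrightarrow> z * 0"
      by (intro tendsto_intros LIMSEQ_power_zero q)
    moreover have "isCont F 0"
      unfolding F_def by (rule isCont_powser[of c "1/2"]) (auto intro: sm)
    ultimately have "(\<lambda>n. F (z * q ^ n)) \<longlonglongrightarrow> F 0"
      by (intro isCont_tendsto_compose[of 0 F]) auto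
    thus "(\<lambda>n. F z * qpoch z q n) \<longlonglongrightarrow> qpoch_inf (a * z) q * F 0"
      unfolding iter by (intro tendsto_intros qpoch_LIMSEQ q)
  qed
  moreover have "F 0 = 1"
    unfolding F_def powser_zero by (simp add: c_def)
  moreover have "qpoch_inf z q \<noteq> 0"
    by (intro qpoch_inf_nonzero qpoch_nonzero q z)
  ultimately have "F z = qpoch_inf (a * z) q / qpoch_inf z q"
    by (simp add: field_simps)
  thus ?thesis
    using summable_sums[OF sm[OF z]] by (simp add: F_def c_def)
qed

section \<open>Generating functions of the shifted Hahn polynomials\<close>

text \<open>
  The series is the Cauchy product of the \<open>q\<close>-binomial series with parameter \<open>\<alpha>\<close> at \<open>xz\<close> and the one
  with parameter \<open>0\<close> at \<open>z\<close>, whose coefficients are \<open>1 / (q;q)\<^sub>m\<close>.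
\<close>

lemma hahn_generating_function:
  assumes q: "norm q < 1" and z: "norm z < 1" and xz: "norm (x * z) < 1"
  shows "(\<lambda>m. hahn_poly q \<alpha> m x * (z ^ m / qpoch q q m)) sums
           (qpoch_inf (\<alpha> * (x * z)) q / (qpoch_inf (x * z) q * qpoch_inf z q))"
proof -
  let ?u = "\<lambda>k. qpoch \<alpha> q k / qpoch q q k * (x * z) ^ k"
  let ?v = "\<lambda>k. qpoch 0 q k / qpoch q q k * z ^ k"
  have "(\<lambda>m. \<Sum>k\<le>m. ?u k * ?v (m - k)) sums ((\<Sum>k. ?u k) * (\<Sum>k. ?v k))"
    by (intro Cauchy_product_sums summable_norm_qbinomial q z xz)
  moreover have "(\<Sum>k\<le>m. ?u k * ?v (m - k)) = hahn_poly q \<alpha> m x * (z ^ m / qpoch q q m)" for m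
    unfolding hahn_poly_def sum_distrib_right
  proof (rule sum.cong[OF refl])
    fix k assume "k \<in> {..m}"
    hence "z ^ m = z ^ k * z ^ (m - k)" by (simp flip: power_add)
    thus "?u k * ?v (m - k) = qbinom q m k * qpoch \<alpha> q k * x ^ k * (z ^ m / qpoch q q m)"
      using qpoch_nonzero[OF q q] by (simp add: qbinom_def power_mult_distrib)
  qed
  moreover have "qpoch_inf 0 q = 1" by (simp add: qpoch_inf_def)
  ultimately show ?thesis
    using q_binomial_theorem[OF q xz, of \<alpha>] q_binomial_theorem[OF q z, of 0]
    by (simp add: sums_iff)
qed

text \<open>
  Induction on \<open>j\<close>, with the induction hypothesis applied both at \<open>z\<close> and at \<open>qz\<close>: the two sides
  obey the recurrence \<open>z G\<^bsub>j+1\<^esub>(z) = G\<^sub>j(z) - G\<^sub>j(qz)\<close>. It determines \<open>G\<^bsub>j+1\<^esub>(z)\<close> only for \<open>z \<noteq> 0\<close>;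
  at \<open>z = 0\<close> the series reduces to its first term and the claim to the definition of the Hahn
  polynomials.
\<close>

theorem hahn_shifted_generating_function:
  assumes q: "norm q < 1" and z: "norm z < 1" and xz: "norm (x * z) < 1"
    and nz: "\<And>k. qpoch (\<alpha> * (x * z)) q k \<noteq> 0"
  shows "(\<lambda>m. hahn_poly q \<alpha> (m + j) x * (z ^ m / qpoch q q m)) sums
           (qpoch_inf (\<alpha> * (x * z)) q / (qpoch_inf (x * z) q * qpoch_inf z q) *
            (\<Sum>k\<le>j. qbinom q j k * (qpoch \<alpha> q k * qpoch z q k * x ^ k / qpoch (\<alpha> * (x * z)) q k)))"
  using z xz nz
proof (induction j arbitrary: z)
  case 0
  thus ?case using hahn_generating_function[OF q] q by simp
next
  case (Suc j)
  define G where "G i w m = hahn_poly q \<alpha> (m + i) x * (w ^ m / qpoch q q m)" for i w m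
  define P where "P w = qpoch_inf (\<alpha> * (x * w)) q / (qpoch_inf (x * w) q * qpoch_inf w q)" for w
  define T where "T w k = qpoch \<alpha> q k * qpoch w q k * x ^ k / qpoch (\<alpha> * (x * w)) q k" for w k
  define H where "H i w = (\<Sum>k\<le>i. qbinom q i k * T w k)" for i w
  have "G (Suc j) z sums (P z * H (Suc j) z)"
  proof (cases "z = 0")
    case True
    have "G (Suc j) z sums G (Suc j) z 0"
      using sums_finite[of "{0}" "G (Suc j) z"] True by (simp add: G_def)
    moreover have "P z * H (Suc j) z = G (Suc j) z 0"
      by (simp add: True P_def H_def T_def G_def hahn_poly_def qpoch_inf_def mult_ac)
    ultimately show ?thesis by simp
  next
    case False
    have eqs: "\<alpha> * (x * (z * q)) = \<alpha> * (x * z) * q" "x * (z * q) = x * z * q" by simp_all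
    have shrink: "norm (w * q) < 1" if "norm w < 1" for w :: complex
      using q that mult_left_mono[of "norm q" 1 "norm w"] by (simp add: norm_mult)
    have nz1: "1 - \<alpha> * (x * z) \<noteq> 0" and nzq: "qpoch (\<alpha> * (x * z) * q) q k \<noteq> 0" for k
      using Suc.prems(3)[of "Suc k"] by (auto simp: qpoch_Suc_shift)
    have IH: "G j z sums (P z * H j z)" "G j (z * q) sums (P (z * q) * H j (z * q))"
    proof -
      show "G j z sums (P z * H j z)"
        unfolding G_def P_def H_def T_def using Suc.prems by (rule Suc.IH)
      show "G j (z * q) sums (P (z * q) * H j (z * q))"
        unfolding G_def P_def H_def T_def
        by (rule Suc.IH) (use Suc.prems shrink[of z] shrink[of "x * z"] nzq in \<open>auto simp: mult.assoc\<close>)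
    qed
    have Pshift: "P z * ((1 - x * z) * (1 - z)) = P (z * q) * (1 - \<alpha> * (x * z))"
    proof -
      have "1 - x * z \<noteq> 0" "1 - z \<noteq> 0" using Suc.prems by auto
      thus ?thesis
        unfolding P_def eqs qpoch_inf_shift[OF q, of z] qpoch_inf_shift[OF q, of "x * z"]
          qpoch_inf_shift[OF q, of "\<alpha> * (x * z)"]
        by (simp add: divide_simps) (simp add: mult_ac)
    qed
    \<comment> \<open>The summand of the closed form at \<open>qz\<close>, brought over the prefactor at \<open>z\<close>.\<close>
    define S where
      "S k = (1 - x * z) * (qpoch \<alpha> q k * qpoch z q (Suc k) * x ^ k / qpoch (\<alpha> * (x * z)) q (Suc k))"
      for k
    have TS: "P (z * q) * T (z * q) k = P z * S k" for k
    proof -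
      have "P z * S k = (P z * ((1 - x * z) * (1 - z))) *
          (qpoch \<alpha> q k * qpoch (z * q) q k * x ^ k / qpoch (\<alpha> * (x * z)) q (Suc k))"
        by (simp add: S_def qpoch_Suc_shift[of z])
      also have "\<dots> = P (z * q) * T (z * q) k"
        unfolding Pshift T_def eqs using nz1 nzq
        by (simp add: qpoch_Suc_shift mult.assoc)
      finally show ?thesis by simp
    qed
    \<comment> \<open>The recurrence for a single summand; the weights \<open>q\<^sup>k\<close> and \<open>1\<close> are those of the \<open>q\<close>-Pascal rule.\<close>
    have diff: "T z k - S k = z * (q ^ k * T z k + T z (Suc k))" for k
    proof -
      have d: "qpoch (\<alpha> * (x * z)) q k \<noteq> 0" "1 - \<alpha> * (x * z) * q ^ k \<noteq> 0"
        using Suc.prems(3)[of "Suc k"] by (auto simp: qpoch_Suc)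
      define R where "R = qpoch \<alpha> q k * qpoch z q k * x ^ k / qpoch (\<alpha> * (x * z)) q (Suc k)"
      have "T z k = R * (1 - \<alpha> * (x * z) * q ^ k)"
        using d by (simp add: T_def R_def qpoch_Suc)
      moreover have "S k = R * ((1 - x * z) * (1 - z * q ^ k))"
        by (simp add: S_def R_def qpoch_Suc)
      moreover have "T z (Suc k) = R * ((1 - \<alpha> * q ^ k) * (1 - z * q ^ k) * x)"
        by (simp add: T_def R_def qpoch_Suc)
      ultimately show ?thesis by (simp only:) (simp add: algebra_simps)
    qed
    have Hrec: "P z * H j z - P (z * q) * H j (z * q) = z * (P z * H (Suc j) z)"
    proof -
      have "(\<Sum>k\<le>j. qbinom q j k * (q ^ k * T z k + T z (Suc k))) = H (Suc j) z"
      proof -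
        have "H (Suc j) z = qbinom q (Suc j) 0 * T z 0 +
            (\<Sum>k\<le>j. qbinom q (Suc j) (Suc k) * T z (Suc k))"
          unfolding H_def by (rule sum.atMost_Suc_shift)
        also have "(\<Sum>k\<le>j. qbinom q (Suc j) (Suc k) * T z (Suc k)) =
            (\<Sum>k<j. qbinom q (Suc j) (Suc k) * T z (Suc k)) + T z (Suc j)"
          using q by (simp flip: lessThan_Suc_atMost)
        also have "(\<Sum>k<j. qbinom q (Suc j) (Suc k) * T z (Suc k)) =
            (\<Sum>k<j. qbinom q j (Suc k) * (q ^ Suc k * T z (Suc k))) + (\<Sum>k<j. qbinom q j k * T z (Suc k))"
          unfolding sum.distrib[symmetric]
          by (intro sum.cong refl, subst qbinom_pascal[OF q]) (auto simp: algebra_simps)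
        also have "qbinom q (Suc j) 0 * T z 0 + (\<dots> + T z (Suc j)) =
            (qbinom q j 0 * (q ^ 0 * T z 0) + (\<Sum>k<j. qbinom q j (Suc k) * (q ^ Suc k * T z (Suc k)))) +
            ((\<Sum>k<j. qbinom q j k * T z (Suc k)) + qbinom q j j * T z (Suc j))"
          using q by simp
        also have "\<dots> = (\<Sum>k\<le>j. qbinom q j k * (q ^ k * T z k)) + (\<Sum>k\<le>j. qbinom q j k * T z (Suc k))"
          by (simp only: sum.atMost_shift[of "\<lambda>k. qbinom q j k * (q ^ k * T z k)"]
              sum.lessThan_Suc[of "\<lambda>k. qbinom q j k * T z (Suc k)", symmetric]
              lessThan_Suc_atMost)
        finally show ?thesis by (simp add: algebra_simps sum.distrib)
      qed
      moreover have "P z * H j z - P (z * q) * H j (z * q) =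
          P z * (\<Sum>k\<le>j. qbinom q j k * (T z k - S k))"
      proof -
        have "P (z * q) * H j (z * q) = (\<Sum>k\<le>j. qbinom q j k * (P (z * q) * T (z * q) k))"
          by (simp add: H_def sum_distrib_left mult_ac)
        also have "\<dots> = P z * (\<Sum>k\<le>j. qbinom q j k * S k)"
          unfolding TS by (simp add: sum_distrib_left mult_ac)
        finally show ?thesis by (simp add: H_def algebra_simps sum_subtractf)
      qed
      moreover have "(\<Sum>k\<le>j. qbinom q j k * (T z k - S k)) =
          z * (\<Sum>k\<le>j. qbinom q j k * (q ^ k * T z k + T z (Suc k)))"
        unfolding diff sum_distrib_left by (intro sum.cong refl) (simp only: ac_simps)
      ultimately show ?thesis by (simp only: ac_simps)
    qed
    have "(\<lambda>m. G j z m - G j (z * q) m) sums (z * (P z * H (Suc j) z))"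
      unfolding Hrec[symmetric] by (intro sums_diff IH)
    hence "(\<lambda>m. G j z (Suc m) - G j (z * q) (Suc m)) sums (z * (P z * H (Suc j) z))"
      by (subst sums_Suc_iff) (simp add: G_def)
    moreover have "G j z (Suc m) - G j (z * q) (Suc m) = z * G (Suc j) z m" for m
    proof -
      have "1 - q * q ^ m \<noteq> 0" "qpoch q q m \<noteq> 0"
        using qpoch_nonzero[OF q q, of "Suc m"] by (auto simp: qpoch_Suc)
      thus ?thesis
        by (simp add: G_def qpoch_Suc divide_simps power_mult_distrib) (simp add: algebra_simps)
    qed
    ultimately have "(\<lambda>m. z * G (Suc j) z m) sums (z * (P z * H (Suc j) z))" by simp
    thus ?thesis using False by (simp add: sums_mult_iff)
  qed
  thus ?case unfolding G_def P_def H_def T_def .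
qed



section \<open>Rearranging double series\<close>

text \<open>
  A product bound makes the double series absolutely convergent, so that it may be summed along
  rows or along antidiagonals.
\<close>

lemma sums_diagonals:
  fixes f :: "nat \<Rightarrow> nat \<Rightarrow> complex" and A B :: "nat \<Rightarrow> real"
  assumes bound: "\<And>j m. norm (f j m) \<le> A j * B m"
    and A: "summable A" "\<And>j. A j \<ge> 0" and B: "summable B" "\<And>m. B m \<ge> 0"
  shows "(\<lambda>n. \<Sum>j\<le>n. f j (n - j)) sums (\<Sum>j. \<Sum>m. f j m)"
proof -
  have "(\<lambda>(j, m). A j * B m) summable_on (UNIV \<times> UNIV)"
  proof (rule summable_on_SigmaI)
    have B': "(B has_sum suminf B) UNIV"
      using B by (intro norm_summable_imp_has_sum) (auto simp: summable_sums)
    show "((\<lambda>m. case (j, m) of (j, m) \<Rightarrow> A j * B m) has_sum A j * suminf B) UNIV" for j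
      using has_sum_cmult_right[OF B'] by simp
    show "(\<lambda>j. A j * suminf B) summable_on UNIV"
      using A by (intro summable_on_cmult_left norm_summable_imp_summable_on) auto
  qed (use A B in auto)
  hence "(\<lambda>p. norm (case p of (j, m) \<Rightarrow> f j m)) summable_on (UNIV \<times> UNIV)"
    by (rule Infinite_Sum.abs_summable_on_comparison_test') (use bound in auto)
  hence smf: "(\<lambda>(j, m). f j m) summable_on (UNIV \<times> UNIV)"
    by (rule abs_summable_summable)
  then obtain S where S: "((\<lambda>(j, m). f j m) has_sum S) (UNIV \<times> UNIV)"
    by (auto simp: summable_on_def)
  have row: "(f j has_sum (\<Sum>m. f j m)) UNIV" for j
  proof -
    have "f j summable_on UNIV"
      using smf by (rule summable_on_SigmaD1) simp
    then obtain s where s: "(f j has_sum s) UNIV" by (auto simp: summable_on_def)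
    with sums_unique[OF has_sum_imp_sums[OF s]] show ?thesis by simp
  qed
  have "((\<lambda>j. \<Sum>m. f j m) has_sum S) UNIV"
    using S by (rule has_sum_SigmaD) (use row in simp)
  hence "S = (\<Sum>j. \<Sum>m. f j m)"
    by (intro sums_unique has_sum_imp_sums)
  moreover have "((\<lambda>(n, j). f j (n - j)) has_sum S) (SIGMA n:UNIV. {..n})"
  proof -
    have "((\<lambda>(n, j). f j (n - j)) has_sum S) (SIGMA n:UNIV. {..n}) \<longleftrightarrow>
        ((\<lambda>(j, m). f j m) has_sum S) (UNIV \<times> UNIV)"
      by (rule has_sum_reindex_bij_witness[of _ "\<lambda>(j, m). (j + m, j)" "\<lambda>(n, j). (j, n - j)"]) auto
    with S show ?thesis by simp
  qed
  hence "((\<lambda>n. \<Sum>j\<le>n. f j (n - j)) has_sum S) UNIV"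
    by (rule has_sum_SigmaD) (use has_sum_finite in simp)
  ultimately show ?thesis
    using has_sum_imp_sums by simp
qed

section \<open>Growth estimates\<close>

text \<open>
  The quadratic exponent outweighs every geometric growth: the ratio of consecutive terms,
  \<open>\<rho>\<^sup>n r\<close>, tends to \<open>0\<close>.
\<close>

lemma summable_theta:
  fixes \<rho> r :: real
  assumes "0 \<le> \<rho>" "\<rho> < 1"
  shows "summable (\<lambda>n. \<rho> ^ (n * (n - 1) div 2) * r ^ n)"
proof -
  have "(\<lambda>n. norm (\<rho> ^ n * r)) \<longlonglongrightarrow> norm (0 * r)"
    using assms by (intro tendsto_intros LIMSEQ_power_zero) auto
  hence "eventually (\<lambda>n. norm (\<rho> ^ n * r) < 1 / 2) sequentially"
    by (rule order_tendstoD) simp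
  then obtain N where N: "\<And>n. n \<ge> N \<Longrightarrow> norm (\<rho> ^ n * r) < 1 / 2"
    by (auto simp: eventually_sequentially)
  show ?thesis
  proof (rule summable_ratio_test[of "1 / 2" N])
    fix n assume n: "n \<ge> N"
    have "\<rho> ^ (Suc n * (Suc n - 1) div 2) * r ^ Suc n =
        (\<rho> ^ n * r) * (\<rho> ^ (n * (n - 1) div 2) * r ^ n)"
      unfolding triangular_Suc by (simp only: power_add power_Suc ac_simps)
    thus "norm (\<rho> ^ (Suc n * (Suc n - 1) div 2) * r ^ Suc n)
        \<le> 1 / 2 * norm (\<rho> ^ (n * (n - 1) div 2) * r ^ n)"
      using mult_right_mono[OF less_imp_le[OF N[OF n]] norm_ge_zero[of "\<rho> ^ (n * (n - 1) div 2) * r ^ n"]]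
      by (simp only: norm_mult)
  qed simp
qed

lemma qbinom_bounded:
  assumes q: "norm q < 1"
  obtains C where "C > 0" "\<And>n k. norm (qbinom q n k) \<le> C"
proof -
  obtain U where U: "U > 0" "\<And>n. norm (qpoch q q n) \<le> U"
    using qpoch_bounded[OF q] by blast
  obtain V where V: "V > 0" "\<And>n. norm (inverse (qpoch q q n)) \<le> V"
    using inverse_qpoch_bounded[OF q qpoch_nonzero[OF q q]] by blast
  show ?thesis
  proof (rule that[of "U * (V * V)"])
    show "norm (qbinom q n k) \<le> U * (V * V)" for n k
      unfolding qbinom_def divide_inverse inverse_mult_distrib norm_mult
      using U V by (intro mult_mono mult_nonneg_nonneg) (auto intro: less_imp_le)
  qed (use U V in auto)
qed

text \<open>
  All coefficients of the Hahn polynomials are bounded by one constant, so only the \<open>n + 1\<close> powers of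
  \<open>x\<close> matter. The growth rate \<open>max 1 \<bar>x\<bar>\<close> is what makes \<open>\<bar>z\<bar> < 1\<close> and \<open>\<bar>xz\<bar> < 1\<close> the right
  conditions for convergence of the series \<open>G\<^sub>j(z)\<close>.
\<close>

lemma hahn_poly_bound:
  assumes q: "norm q < 1"
  obtains C where "C > 0"
    "\<And>n. norm (hahn_poly q \<alpha> n x) \<le> C * (real (Suc n) * max 1 (norm x) ^ n)"
proof -
  obtain A where A: "A > 0" "\<And>n. norm (qpoch \<alpha> q n) \<le> A"
    using qpoch_bounded[OF q] by blast
  obtain B where B: "B > 0" "\<And>n k. norm (qbinom q n k) \<le> B"
    using qbinom_bounded[OF q] by blast
  show ?thesis
  proof (rule that[of "B * A"])
    fix n
    have "norm (qbinom q n k * qpoch \<alpha> q k * x ^ k) \<le> B * A * max 1 (norm x) ^ n" if "k \<le> n" for k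
    proof -
      have "norm x ^ k \<le> max 1 (norm x) ^ k" by (intro power_mono) auto
      also have "\<dots> \<le> max 1 (norm x) ^ n" using that by (intro power_increasing) auto
      finally show ?thesis
        unfolding norm_mult norm_power using A B
        by (intro mult_mono mult_nonneg_nonneg) (auto intro: less_imp_le)
    qed
    hence "norm (hahn_poly q \<alpha> n x) \<le> (\<Sum>k\<le>n. B * A * max 1 (norm x) ^ n)"
      unfolding hahn_poly_def by (intro sum_norm_le) auto
    thus "norm (hahn_poly q \<alpha> n x) \<le> B * A * (real (Suc n) * max 1 (norm x) ^ n)"
      by (simp add: mult_ac)
  qed (use A B in auto)
qed

section \<open>The bilinear generating function\<close>

definition Phi11_0_term :: "complex \<Rightarrow> complex \<Rightarrow> complex \<Rightarrow> nat \<Rightarrow> complex" where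
  "Phi11_0_term a q z n = (-1) ^ n * q ^ (n * (n - 1) div 2) * (qpoch a q n / qpoch q q n) * z ^ n"

lemma Phi11_0_term_bound:
  assumes q: "norm q < 1"
  obtains C where "C > 0"
    "\<And>n z. norm (Phi11_0_term a q z n) \<le> C * (norm q ^ (n * (n - 1) div 2) * norm z ^ n)"
proof -
  obtain C where C: "C > 0" "\<And>n. norm (qpoch a q n / qpoch q q n) \<le> C"
    using qpoch_ratio_bounded[OF q qpoch_nonzero[OF q q]] by blast
  show ?thesis
  proof (rule that[OF C(1)])
    fix n z
    have "norm (Phi11_0_term a q z n) = 
        norm (qpoch a q n / qpoch q q n) * (norm q ^ (n * (n - 1) div 2) * norm z ^ n)"
      by (simp only: Phi11_0_term_def norm_mult norm_power norm_minus_cancel norm_one power_one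
          mult_1_left ac_simps)
    also have "\<dots> \<le> C * (norm q ^ (n * (n - 1) div 2) * norm z ^ n)"
      using C by (intro mult_right_mono) auto
    finally show "norm (Phi11_0_term a q z n) \<le> C * (norm q ^ (n * (n - 1) div 2) * norm z ^ n)" .
  qed
qed

text \<open>
  This identity links the two sides of the theorem. It combines \<open>(a;q)\<^bsub>k+n\<^esub> = (a;q)\<^sub>k (aq\<^sup>k;q)\<^sub>n\<close> with
  the additivity of \<open>n(n-1)/2\<close> up to the cross term \<open>kn\<close>, which turns the argument \<open>z\<close> of the second
  factor into \<open>zq\<^sup>k\<close>.
\<close>

lemma Phi11_0_term_add:
  assumes q: "norm q < 1"
  shows "Phi11_0_term a q z (k + n) * qbinom q (k + n) k =
           Phi11_0_term a q z k * Phi11_0_term (a * q ^ k) q (z * q ^ k) n"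
proof -
  have "qpoch q q i \<noteq> 0" for i by (rule qpoch_nonzero[OF q q])
  moreover have "q ^ ((k + n) * (k + n - 1) div 2) =
      q ^ (k * (k - 1) div 2) * q ^ (n * (n - 1) div 2) * (q ^ k) ^ n"
    by (simp only: triangular_add power_add power_mult)
  ultimately show ?thesis
    unfolding Phi11_0_term_def qbinom_def qpoch_add[of a q k n]
    by (simp add: power_add power_mult_distrib)
qed

lemma hahn_cauchy_term:
  assumes q: "norm q < 1"
  shows "hahn_poly q \<alpha> n x * cauchy_poly q n lam mu a * (t ^ n / qpoch q q n) =
    (\<Sum>j\<le>n. Phi11_0_term a q (mu * t) j *
       (hahn_poly q \<alpha> (n - j + j) x * ((lam * t) ^ (n - j) / qpoch q q (n - j))))"
proof -
  have "qbinom q n j * (- 1) ^ j * q ^ (j * (j - 1) div 2) * qpoch a q j * lam ^ (n - j) * mu ^ j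
      * (t ^ n / qpoch q q n) =
      Phi11_0_term a q (mu * t) j * ((lam * t) ^ (n - j) / qpoch q q (n - j))" if "j \<le> n" for j
  proof -
    have "t ^ n = t ^ j * t ^ (n - j)" using that by (simp flip: power_add)
    thus ?thesis
      using qpoch_nonzero[OF q q] by (simp add: Phi11_0_term_def qbinom_def power_mult_distrib)
  qed
  hence "cauchy_poly q n lam mu a * (t ^ n / qpoch q q n) =
      (\<Sum>j\<le>n. Phi11_0_term a q (mu * t) j * ((lam * t) ^ (n - j) / qpoch q q (n - j)))"
    unfolding cauchy_poly_def sum_distrib_right by (intro sum.cong) auto
  hence "hahn_poly q \<alpha> n x * cauchy_poly q n lam mu a * (t ^ n / qpoch q q n) =
      (\<Sum>j\<le>n. hahn_poly q \<alpha> n x * (Phi11_0_term a q (mu * t) j * ((lam * t) ^ (n - j) / qpoch q q (n - j))))"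
    by (simp only: mult.assoc sum_distrib_left)
  also have "\<dots> = (\<Sum>j\<le>n. Phi11_0_term a q (mu * t) j *
       (hahn_poly q \<alpha> (n - j + j) x * ((lam * t) ^ (n - j) / qpoch q q (n - j))))"
    by (intro sum.cong) auto
  finally show ?thesis .
qed

text \<open>
  The rearrangement of the left-hand side. The Hahn polynomial of index \<open>m + j\<close> couples the two
  indices through the factor \<open>m + j + 1\<close> of its bound; \<open>m + j + 1 \<le> (m + 1) 2\<^sup>j\<close> decouples them, and
  the factor \<open>2\<^sup>j\<close> is absorbed by \<open>summable_theta\<close>.
\<close>

lemma hahn_cauchy_sums:
  assumes q: "norm q < 1" and z: "norm (lam * t) < 1" and xz: "norm (x * (lam * t)) < 1"
  shows "(\<lambda>n. hahn_poly q \<alpha> n x * cauchy_poly q n lam mu a * (t ^ n / qpoch q q n)) sums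
    (\<Sum>j. \<Sum>m. Phi11_0_term a q (mu * t) j *
        (hahn_poly q \<alpha> (m + j) x * ((lam * t) ^ m / qpoch q q m)))"
proof -
  define z where "z = lam * t"
  define X where "X = max 1 (norm x)"
  have Xz: "X * norm z < 1"
    using z xz by (simp add: X_def z_def max_def norm_mult)
  have X: "X \<ge> 1" by (simp add: X_def)
  obtain K where K: "K > 0"
    "\<And>n z. norm (Phi11_0_term a q z n) \<le> K * (norm q ^ (n * (n - 1) div 2) * norm z ^ n)"
    using Phi11_0_term_bound[OF q] by blast
  obtain C where C: "C > 0" "\<And>n. norm (hahn_poly q \<alpha> n x) \<le> C * (real (Suc n) * X ^ n)"
    using hahn_poly_bound[OF q] unfolding X_def by blast
  obtain V where V: "V > 0" "\<And>n. norm (inverse (qpoch q q n)) \<le> V"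
    using inverse_qpoch_bounded[OF q qpoch_nonzero[OF q q]] by blast
  define A where "A j = K * C * V * (norm q ^ (j * (j - 1) div 2) * (norm (mu * t) * (2 * X)) ^ j)" for j
  define B where "B m = real (Suc m) * (X * norm z) ^ m" for m
  define f where "f j m = Phi11_0_term a q (mu * t) j *
        (hahn_poly q \<alpha> (m + j) x * (z ^ m / qpoch q q m))" for j m
  have "(\<lambda>n. \<Sum>j\<le>n. f j (n - j)) sums (\<Sum>j. \<Sum>m. f j m)"
  proof (rule sums_diagonals[of f A B])
    fix j m
    have "real (Suc (m + j)) \<le> real (Suc m) * 2 ^ j"
    proof -
      have "Suc j \<le> 2 ^ j" by (simp add: Suc_le_eq less_exp)
      hence "Suc m * Suc j \<le> Suc m * 2 ^ j" by (rule mult_le_mono2)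
      moreover have "Suc (m + j) \<le> Suc m * Suc j" by simp
      ultimately have "Suc (m + j) \<le> Suc m * 2 ^ j" by linarith
      hence "real (Suc (m + j)) \<le> real (Suc m * 2 ^ j)" by (simp only: of_nat_le_iff)
      thus ?thesis by (simp only: of_nat_mult of_nat_power of_nat_numeral)
    qed
    hence "C * (real (Suc (m + j)) * X ^ (m + j)) \<le> C * ((real (Suc m) * 2 ^ j) * X ^ (m + j))"
      using C X by (intro mult_left_mono mult_right_mono) auto
    with C(2)[of "m + j"]
    have "norm (hahn_poly q \<alpha> (m + j) x) \<le> C * ((real (Suc m) * 2 ^ j) * X ^ (m + j))"
      by (rule order_trans)
    hence "norm (f j m) \<le> (K * (norm q ^ (j * (j - 1) div 2) * norm (mu * t) ^ j)) *
        ((C * ((real (Suc m) * 2 ^ j) * X ^ (m + j))) * (norm z ^ m * V))"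
      unfolding f_def divide_inverse norm_mult norm_power using K C V X K(2)[of "mu * t" j]
      by (intro mult_mono mult_nonneg_nonneg zero_le_power) (auto simp: norm_mult intro: less_imp_le)
    also have "\<dots> = A j * B m"
      by (simp add: A_def B_def power_mult_distrib power_add)
    finally show "norm (f j m) \<le> A j * B m" .
  next
    show "summable A"
      unfolding A_def using q by (intro summable_mult summable_theta) auto
    show "A j \<ge> 0" for j
      unfolding A_def using K C V X by (intro mult_nonneg_nonneg zero_le_power) auto
    show "summable B"
      unfolding B_def using geometric_deriv_sums[of "X * norm z"] Xz X by (auto simp: sums_iff)
    show "B m \<ge> 0" for m
      unfolding B_def using X by (intro mult_nonneg_nonneg zero_le_power) auto
  qed
  thus ?thesis
    unfolding f_def z_def hahn_cauchy_term[OF q] .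
qed

text \<open>
  The double series on the right-hand side, with rows indexed by \<open>k\<close> and with \<open>n\<close> the index of the
  inner \<open>\<^sub>1\<Phi>\<^sub>1\<close>, is rearranged along \<open>k + n = j\<close>. By \<open>Phi11_0_term_add\<close> the \<open>j\<close>-th antidiagonal is the
  closed form of \<open>hahn_shifted_generating_function\<close> apart from the prefactor, hence equals the
  \<open>j\<close>-th row on the left-hand side.
\<close>

theorem hahn_cauchy_generating_function:
  assumes q: "norm q < 1" and z: "norm (lam * t) < 1" and xz: "norm (x * (lam * t)) < 1"
    and nz: "\<And>k. qpoch (\<alpha> * (x * (lam * t))) q k \<noteq> 0"
  shows "(\<lambda>n. hahn_poly q \<alpha> n x * cauchy_poly q n lam mu a * (t ^ n / qpoch q q n)) sums
    (qpoch_inf (\<alpha> * (x * (lam * t))) q / (qpoch_inf (x * (lam * t)) q * qpoch_inf (lam * t) q) *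
      (\<Sum>k. Phi11_0_term a q (mu * t) k *
        (qpoch \<alpha> q k * qpoch (lam * t) q k * x ^ k / qpoch (\<alpha> * (x * (lam * t))) q k) *
        Phi11_0 (a * q ^ k) q (mu * t * q ^ k)))"
proof -
  define z where "z = lam * t"
  define y where "y = mu * t"
  define P where "P = qpoch_inf (\<alpha> * (x * z)) q / (qpoch_inf (x * z) q * qpoch_inf z q)"
  define T where "T k = qpoch \<alpha> q k * qpoch z q k * x ^ k / qpoch (\<alpha> * (x * z)) q k" for k
  define g where "g k n = Phi11_0_term a q y k * T k * Phi11_0_term (a * q ^ k) q (y * q ^ k) n" for k n
  \<comment> \<open>The first form of \<open>g\<close> is adapted to summation over \<open>n\<close>, this one to summation over \<open>k + n = j\<close>
    and to an estimate that is uniform in \<open>k\<close>.\<close>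
  have g_eq: "g k n = Phi11_0_term a q y (k + n) * (qbinom q (k + n) k * T k)" for k n
    using Phi11_0_term_add[OF q, of a y k n] by (simp add: g_def mult_ac)
  obtain K where K: "K > 0"
    "\<And>n z. norm (Phi11_0_term a q z n) \<le> K * (norm q ^ (n * (n - 1) div 2) * norm z ^ n)"
    using Phi11_0_term_bound[OF q] by blast
  obtain Q where Q: "Q > 0" "\<And>n k. norm (qbinom q n k) \<le> Q"
    using qbinom_bounded[OF q] by blast
  obtain D where D: "D > 0" "\<And>k. norm (qpoch \<alpha> q k / qpoch (\<alpha> * (x * z)) q k) \<le> D"
    using qpoch_ratio_bounded[OF q nz] unfolding z_def by blast
  obtain Z where Z: "Z > 0" "\<And>k. norm (qpoch z q k) \<le> Z"
    using qpoch_bounded[OF q] by blast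
  have T_bound: "norm (T k) \<le> D * Z * norm x ^ k" for k
  proof -
    have "T k = (qpoch \<alpha> q k / qpoch (\<alpha> * (x * z)) q k) * qpoch z q k * x ^ k"
      by (simp add: T_def)
    hence "norm (T k) = norm (qpoch \<alpha> q k / qpoch (\<alpha> * (x * z)) q k) * norm (qpoch z q k) * norm x ^ k"
      by (simp only: norm_mult norm_power)
    also have "\<dots> \<le> D * Z * norm x ^ k"
      using D Z by (intro mult_right_mono mult_mono) (auto intro: less_imp_le)
    finally show ?thesis .
  qed
  define A where "A k = K * Q * D * Z * (norm q ^ (k * (k - 1) div 2) * (norm y * norm x) ^ k)" for k
  define B where "B n = norm q ^ (n * (n - 1) div 2) * norm y ^ n" for n
  have "(\<lambda>j. \<Sum>k\<le>j. g k (j - k)) sums (\<Sum>k. \<Sum>n. g k n)"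
  proof (rule sums_diagonals[of g A B])
    fix k n
    have "norm q ^ ((k + n) * (k + n - 1) div 2) \<le>
        norm q ^ (k * (k - 1) div 2 + n * (n - 1) div 2)"
      unfolding triangular_add using q by (intro power_decreasing) auto
    hence "K * (norm q ^ ((k + n) * (k + n - 1) div 2) * norm y ^ (k + n)) \<le>
        K * (norm q ^ (k * (k - 1) div 2 + n * (n - 1) div 2) * norm y ^ (k + n))"
      using K by (intro mult_left_mono mult_right_mono) auto
    with K(2)[of y "k + n"] have "norm (Phi11_0_term a q y (k + n)) \<le>
        K * (norm q ^ (k * (k - 1) div 2 + n * (n - 1) div 2) * norm y ^ (k + n))"
      by (rule order_trans)
    hence "norm (g k n) \<le> (K * (norm q ^ (k * (k - 1) div 2 + n * (n - 1) div 2) * norm y ^ (k + n))) *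
        (Q * (D * Z * norm x ^ k))"
      unfolding g_eq norm_mult using K Q D Z T_bound
      by (intro mult_mono mult_nonneg_nonneg zero_le_power) (auto intro: less_imp_le)
    also have "\<dots> = A k * B n"
      by (simp only: A_def B_def power_mult_distrib power_add ac_simps)
    finally show "norm (g k n) \<le> A k * B n" .
  next
    show "summable A"
      unfolding A_def using q by (intro summable_mult summable_theta) auto
    show "A j \<ge> 0" for j
      unfolding A_def using K Q D Z by (intro mult_nonneg_nonneg zero_le_power) auto
    show "summable B"
      unfolding B_def using q by (intro summable_theta) auto
    show "B m \<ge> 0" for m
      unfolding B_def by (intro mult_nonneg_nonneg zero_le_power) auto
  qed
  moreover have "(\<Sum>n. g k n) = Phi11_0_term a q y k * T k * Phi11_0 (a * q ^ k) q (y * q ^ k)" for k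
  proof -
    have "summable (\<lambda>n. Phi11_0_term (a * q ^ k) q (y * q ^ k) n)"
    proof -
      obtain K' where K': "K' > 0" "\<And>n z. norm (Phi11_0_term (a * q ^ k) q z n) \<le>
          K' * (norm q ^ (n * (n - 1) div 2) * norm z ^ n)"
        using Phi11_0_term_bound[OF q] by blast
      have "summable (\<lambda>n. K' * (norm q ^ (n * (n - 1) div 2) * norm (y * q ^ k) ^ n))"
        using q by (intro summable_mult summable_theta) auto
      thus ?thesis
        by (rule summable_comparison_test') (rule K'(2))
    qed
    thus ?thesis
      unfolding g_def Phi11_0_def Phi11_0_term_def[symmetric] by (rule suminf_mult)
  qed
  ultimately have "(\<lambda>j. P * (\<Sum>k\<le>j. g k (j - k))) sums
      (P * (\<Sum>k. Phi11_0_term a q y k * T k * Phi11_0 (a * q ^ k) q (y * q ^ k)))"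
    by (intro sums_mult) simp
  moreover have "P * (\<Sum>k\<le>j. g k (j - k)) =
      (\<Sum>m. Phi11_0_term a q y j * (hahn_poly q \<alpha> (m + j) x * (z ^ m / qpoch q q m)))" for j
  proof -
    have "(\<lambda>m. Phi11_0_term a q y j * (hahn_poly q \<alpha> (m + j) x * (z ^ m / qpoch q q m))) sums
        (Phi11_0_term a q y j * (P * (\<Sum>k\<le>j. qbinom q j k * T k)))"
      unfolding P_def T_def
      by (intro sums_mult hahn_shifted_generating_function q) (use z xz nz in \<open>simp_all add: z_def\<close>)
    moreover have "(\<Sum>k\<le>j. g k (j - k)) = Phi11_0_term a q y j * (\<Sum>k\<le>j. qbinom q j k * T k)"
      unfolding sum_distrib_left by (intro sum.cong) (auto simp: g_eq)
    ultimately show ?thesis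
      by (simp add: sums_iff mult_ac)
  qed
  ultimately have "(\<Sum>j. \<Sum>m. Phi11_0_term a q y j * (hahn_poly q \<alpha> (m + j) x * (z ^ m / qpoch q q m))) =
      P * (\<Sum>k. Phi11_0_term a q y k * T k * Phi11_0 (a * q ^ k) q (y * q ^ k))"
    by (simp add: sums_iff)
  thus ?thesis
    using hahn_cauchy_sums[OF q z xz, of \<alpha> mu a] unfolding P_def T_def y_def z_def by simp
qed

theorem theorem4p1:
  fixes q a x t lam mu \<alpha> :: complex and M :: nat
  assumes "0 < norm q" and "norm q < 1"
    and "\<alpha> = q powi (- int M)"
    and "max (norm (lam * t)) (norm (lam * x * t)) < 1"
    and "\<And>k. qpoch (\<alpha> * lam * x * t) q k \<noteq> 0"
  shows "(\<lambda>n. hahn_poly q \<alpha> n x * cauchy_poly q n lam mu a * (t ^ n / qpoch q q n)) sums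
    (qpoch_inf (\<alpha> * lam * x * t) q / (qpoch_inf (lam * x * t) q * qpoch_inf (lam * t) q) *
      (\<Sum>k. (-1) ^ k * q ^ (k * (k - 1) div 2)
              * (qpoch a q k * qpoch \<alpha> q k * qpoch (lam * t) q k) * (mu * x * t) ^ k
              / (qpoch (\<alpha> * lam * x * t) q k * qpoch q q k)
              * Phi11_0 (a * q ^ k) q (mu * t * q ^ k)))"
proof -
  have eqs: "x * (lam * t) = lam * x * t" "\<alpha> * (lam * x * t) = \<alpha> * lam * x * t"
    by (simp_all only: ac_simps)
  have "Phi11_0_term a q (mu * t) k *
        (qpoch \<alpha> q k * qpoch (lam * t) q k * x ^ k / qpoch (\<alpha> * lam * x * t) q k) =
      (-1) ^ k * q ^ (k * (k - 1) div 2)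
              * (qpoch a q k * qpoch \<alpha> q k * qpoch (lam * t) q k) * (mu * x * t) ^ k
              / (qpoch (\<alpha> * lam * x * t) q k * qpoch q q k)" for k
    by (simp add: Phi11_0_term_def power_mult_distrib mult_ac)
  thus ?thesis
    using hahn_cauchy_generating_function[of q lam t x \<alpha> mu a] assms unfolding eqs by simp
qed

end
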